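(* Let $\alpha>1$, $\beta>0$, let $\pi$ be the Gamma probability measure on $(0,+\infty)$ given by $\pi(\mathrm{d}r)=\frac{1}{\Gamma(\alpha)\beta^\alpha}r^{\alpha-1}\exp(-r/\beta)\,\mathrm{d}r$, and let $R=\int_0^{+\infty}\frac1r\pi(\mathrm{d}r)$. For any $0<a\le b\le1$ the following hold: (i) if $0<q<1-\alpha^{-1}$, then $$\overline{\mathrm{TsVaR}}_a\ge\overline{\mathrm{TsVaR}}_b\ge\overline{\mathrm{TsVaR}}_1\ge R;$$ (ii) if $q\ge1$, then $$\underline{\mathrm{TsVaR}}_a\le\underline{\mathrm{TsVaR}}_b\le\underline{\mathrm{TsVaR}}_1\le R.$$
   Context: $\Gamma$ is the Gamma function. The $q$-exponential and $q$-logarithm are defined by $\exp_q(x)=(1+(1-q)x)^{\frac{1}{1-q}}$ for $1+(1-q)x>0$ if $q\ne1$, $\exp_1(x)=\exp(x)$; and $\ln_q(x)=\frac{x^{1-q}-1}{1-q}$ for $x>0$ if $q\neq1$, $\ln_1(x)=\ln(x)$. For $a\in(0,1]$, the upper and lower Tsallis Value-at-Risk (with shape parameter $q$, in the ranges of $q$ indicated in (i) and (ii) respectively) are $$\overline{\mathrm{TsVaR}}_a=\inf_{\lambda>0}\left\{\frac1\lambda\ln_q\left(\frac1a\int_0^{+\infty}\exp_q\left(\frac{\lambda}{r}\right)\pi(\mathrm{d}r)\right)\right\},$$ $$\underline{\mathrm{TsVaR}}_a=\sup_{\lambda>0}\left\{-\frac1\lambda\ln_q\left(\frac1a\int_0^{+\infty}\exp_q\left(-\frac{\lambda}{r}\right)\pi(\mathrm{d}r)\right)\right\}.$$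 *)

theory Defs
  imports "HOL-Probability.Probability"
begin

text \<open>Meaningful for \<open>1 + (1 - q) * x > 0\<close>, which holds at every point where
  \<open>exp_q\<close> is evaluated below for the relevant \<open>q\<close>; elsewhere the value is an artefact of \<open>powr\<close>.\<close>

definition exp_q :: "real \<Rightarrow> real \<Rightarrow> real" where
  "exp_q q x = (if q = 1 then exp x else (1 + (1 - q) * x) powr (1 / (1 - q)))"

definition ln_q :: "real \<Rightarrow> real \<Rightarrow> real" where
  "ln_q q x = (if q = 1 then ln x else (x powr (1 - q) - 1) / (1 - q))"

definition gamma_density :: "real \<Rightarrow> real \<Rightarrow> real \<Rightarrow> real" where
  "gamma_density \<alpha> \<beta> r =
     (if r > 0 then 1 / (Gamma \<alpha> * \<beta> powr \<alpha>) * r powr (\<alpha> - 1) * exp (- r / \<beta>) else 0)"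

text \<open>The second parameter is the scale (not the rate). The measure lives on the whole real line
  and gives no mass to the nonpositive reals.\<close>

definition gamma_measure :: "real \<Rightarrow> real \<Rightarrow> real measure" where
  "gamma_measure \<alpha> \<beta> = density lborel (\<lambda>r. ennreal (gamma_density \<alpha> \<beta> r))"

text \<open>The infimum and supremum are taken in the extended reals, so that they are the genuine
  ones without a boundedness side condition.\<close>

definition upper_TsVaR :: "real measure \<Rightarrow> real \<Rightarrow> real \<Rightarrow> ereal" where
  "upper_TsVaR \<pi> q a =
     (INF l\<in>{0<..}. ereal (1 / l * ln_q q (1 / a * (LINT r:{0<..}|\<pi>. exp_q q (l / r)))))"

definition lower_TsVaR :: "real measure \<Rightarrow> real \<Rightarrow> real \<Rightarrow> ereal" where
  "lower_TsVaR \<pi> q a =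
     (SUP l\<in>{0<..}. ereal (- (1 / l) * ln_q q (1 / a * (LINT r:{0<..}|\<pi>. exp_q q (- l / r)))))"

end

theory Submission imports Defs begin

text \<open>For \<open>q > 0\<close> the function \<open>exp_q\<close> is convex, so Jensen's inequality gives
  \<open>E X \<le> ln_q (E (exp_q X))\<close>; apply this to \<open>X = l / r\<close> and to \<open>X = - l / r\<close>.
  Monotonicity in the level is that of \<open>ln_q\<close>. The condition \<open>q < 1 - 1 / \<alpha>\<close> says that the
  exponent \<open>p = 1 / (1 - q)\<close> is smaller than \<open>\<alpha>\<close>, i.e. that the moment of order \<open>- p\<close>
  of the Gamma measure is finite.\<close>

section \<open>The q-exponential, the q-logarithm and Jensen's inequality\<close>

lemma exp_q_pos:
  assumes "0 < 1 + (1 - q) * x"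
  shows "0 < exp_q q x"
  using assms by (auto simp: exp_q_def)

lemma ln_q_exp_q:
  assumes "0 < 1 + (1 - q) * x"
  shows "ln_q q (exp_q q x) = x"
  using assms by (auto simp: exp_q_def ln_q_def powr_powr)

text \<open>For q > 1 the power \<open>x powr (1 - q)\<close> decreases and the denominator
  \<open>1 - q\<close> is negative, so the two reversals cancel.\<close>

lemma ln_q_mono:
  assumes "0 < x" "x \<le> y"
  shows "ln_q q x \<le> ln_q q y"
proof (cases "q < 1")
  case True
  then show ?thesis
    using assms by (auto simp: ln_q_def divide_right_mono powr_mono2)
next
  case False
  then show ?thesis
    using assms by (auto simp: ln_q_def intro!: divide_right_mono_neg powr_mono2')
qed

lemma borel_measurable_exp_q [measurable]: "exp_q q \<in> borel_measurable borel"
  unfolding exp_q_def by measurable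

text \<open>On its domain \<open>exp_q\<close> has as second derivative q times a power of 1 + (1 -
  q) x, which is nonnegative for q > 0.\<close>

lemma convex_on_exp_q:
  assumes "0 < q" and "convex C" and pos: "\<And>x. x \<in> C \<Longrightarrow> 0 < 1 + (1 - q) * x"
  shows "convex_on C (exp_q q)"
proof (cases "q = 1")
  case True
  have "convex_on C (exp :: real \<Rightarrow> real)"
    by (rule f''_ge0_imp_convex[OF \<open>convex C\<close>, of _ exp exp]) (auto intro!: DERIV_exp)
  then show ?thesis
    using True by (simp add: exp_q_def[abs_def])
next
  case False
  define p where "p = 1 / (1 - q)"
  \<comment> \<open>These are the constants that the chain rule produces: 1 in the first derivative
    and q in the second.\<close>
  have p: "p * (1 - q) = 1" "(p - 1) * (1 - q) = q"
    using False by (auto simp: p_def field_simps)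
  have "convex_on C (\<lambda>x. (1 + (1 - q) * x) powr p)"
  proof (rule f''_ge0_imp_convex[OF \<open>convex C\<close>])
    fix x assume "x \<in> C"
    note pos' = pos[OF this]
    have "((\<lambda>x. (1 + (1 - q) * x) powr p) has_real_derivative
        p * (1 - q) * (1 + (1 - q) * x) powr (p - 1)) (at x)"
      using pos' by (auto intro!: derivative_eq_intros)
    then show "((\<lambda>x. (1 + (1 - q) * x) powr p) has_real_derivative
        (1 + (1 - q) * x) powr (p - 1)) (at x)"
      by (simp add: p)
    have "((\<lambda>x. (1 + (1 - q) * x) powr (p - 1)) has_real_derivative
        (p - 1) * (1 - q) * (1 + (1 - q) * x) powr (p - 1 - 1)) (at x)"
      using pos' by (auto intro!: derivative_eq_intros)
    then show "((\<lambda>x. (1 + (1 - q) * x) powr (p - 1)) has_real_derivative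
        q * (1 + (1 - q) * x) powr (p - 1 - 1)) (at x)"
      by (simp add: p)
    show "0 \<le> q * (1 + (1 - q) * x) powr (p - 1 - 1)"
      using \<open>0 < q\<close> by simp
  qed
  then show ?thesis
    using False by (simp add: exp_q_def[abs_def] p_def)
qed

text \<open>Jensen's inequality for \<open>exp_q\<close>, with \<open>ln_q\<close> then applied to
  both sides. The sign condition keeps X inside the domain of \<open>exp_q\<close>; it covers both q
  < 1 with X = l / r and q \<ge> 1 with X = - l / r.\<close>

lemma (in prob_space)
  assumes "0 < q" and X: "integrable M X" and eX: "integrable M (\<lambda>x. exp_q q (X x))"
    and sgn: "AE x in M. 0 \<le> (1 - q) * X x"
  shows expectation_exp_q_pos: "0 < expectation (\<lambda>x. exp_q q (X x))"
    and expectation_le_ln_q: "expectation X \<le> ln_q q (expectation (\<lambda>x. exp_q q (X x)))"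
proof -
  define I where "I = {x. 0 < 1 + (1 - q) * x}"
  \<comment> \<open>\<open>jensens_inequality\<close> wants the domain displayed as an open
    interval, an open half-line or \<open>UNIV\<close>; the sign of 1 - q decides which.\<close>
  have I: "I = {- 1 / (1 - q) <..} \<or> I = {..< - 1 / (1 - q)} \<or> I = UNIV"
  proof (cases q "1 :: real" rule: linorder_cases)
    case less
    then have "I = {- 1 / (1 - q) <..}"
      by (auto simp: I_def field_simps)
    then show ?thesis by simp
  next
    case equal
    then show ?thesis by (simp add: I_def)
  next
    case greater
    then have "I = {..< - 1 / (1 - q)}"
      by (auto simp: I_def field_simps)
    then show ?thesis by simp
  qed
  have "convex I"
    using I by auto
  then have "convex_on I (exp_q q)"
    using \<open>0 < q\<close> by (intro convex_on_exp_q) (auto simp: I_def)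
  moreover have "AE x in M. X x \<in> I"
    using sgn by eventually_elim (simp add: I_def)
  ultimately have jensen: "exp_q q (expectation X) \<le> expectation (\<lambda>x. exp_q q (X x))"
    using I X eX by (intro jensens_inequality[of X I]) auto
  \<comment> \<open>The mean of X lies in the domain as well, so \<open>exp_q\<close> is positive
    there; this gives the first claim and allows \<open>ln_q\<close> to be applied for the
    second.\<close>
  have "0 \<le> expectation (\<lambda>x. (1 - q) * X x)"
    using sgn by (rule integral_nonneg_AE)
  then have dom: "0 < 1 + (1 - q) * expectation X"
    by simp
  show "0 < expectation (\<lambda>x. exp_q q (X x))"
    using exp_q_pos[OF dom] jensen by linarith
  show "expectation X \<le> ln_q q (expectation (\<lambda>x. exp_q q (X x)))"
    using ln_q_mono[OF exp_q_pos[OF dom] jensen, of q] by (simp add: ln_q_exp_q[OF dom])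
qed

section \<open>Monotonicity in the level\<close>

lemma upper_TsVaR_antimono:
  assumes "0 < a" "a \<le> b"
    and pos: "\<And>l. 0 < l \<Longrightarrow> 0 < (LINT r:{0<..}|\<pi>. exp_q q (l / r))"
  shows "upper_TsVaR \<pi> q b \<le> upper_TsVaR \<pi> q a"
  unfolding upper_TsVaR_def
proof (intro INF_mono)
  \<comment> \<open>The comparison is termwise, with k = l: since 1 / b \<le> 1 / a and the integral
    is positive, \<open>ln_q_mono\<close> applies.\<close>
  fix l :: real assume l: "l \<in> {0<..}"
  then show "\<exists>k\<in>{0<..}. ereal (1 / k * ln_q q (1 / b * (LINT r:{0<..}|\<pi>. exp_q q (k / r))))
      \<le> ereal (1 / l * ln_q q (1 / a * (LINT r:{0<..}|\<pi>. exp_q q (l / r))))"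
    using assms(1,2) pos[of l]
    by (intro bexI[of _ l]) (auto intro!: divide_right_mono ln_q_mono frac_le)
qed

lemma lower_TsVaR_mono:
  assumes "0 < a" "a \<le> b"
    and pos: "\<And>l. 0 < l \<Longrightarrow> 0 < (LINT r:{0<..}|\<pi>. exp_q q (- l / r))"
  shows "lower_TsVaR \<pi> q a \<le> lower_TsVaR \<pi> q b"
  unfolding lower_TsVaR_def
proof (intro SUP_mono)
  fix l :: real assume l: "l \<in> {0<..}"
  then show "\<exists>k\<in>{0<..}. ereal (- (1 / l) * ln_q q (1 / a * (LINT r:{0<..}|\<pi>. exp_q q (- l / r))))
      \<le> ereal (- (1 / k) * ln_q q (1 / b * (LINT r:{0<..}|\<pi>. exp_q q (- k / r))))"
    using assms(1,2) pos[of l]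
    by (intro bexI[of _ l]) (auto intro!: divide_right_mono ln_q_mono frac_le)
qed

section \<open>The Gamma measure and its negative moments\<close>

lemma gamma_density_nonneg:
  assumes "0 < \<alpha>"
  shows "0 \<le> gamma_density \<alpha> \<beta> r"
  using assms by (simp add: gamma_density_def)

lemma borel_measurable_gamma_density [measurable]:
  "gamma_density \<alpha> \<beta> \<in> borel_measurable borel"
  unfolding gamma_density_def[abs_def] by measurable

text \<open>The substitution r = \<beta> t turns the total mass into Euler's integral for
  \<open>Gamma\<close>.\<close>

lemma nn_integral_gamma_density:
  assumes "0 < \<alpha>" "0 < \<beta>"
  shows "(\<integral>\<^sup>+ r. ennreal (gamma_density \<alpha> \<beta> r) \<partial>lborel) = 1"
proof -
  have scale: "\<beta> * gamma_density \<alpha> \<beta> (\<beta> * t)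
      = inverse (Gamma \<alpha>) * (indicator {0..} t * t powr (\<alpha> - 1) / exp t)" for t
  proof (cases "0 < t")
    case True
    \<comment> \<open>The Jacobian \<beta> and the factor split off from
      \<open>(\<beta> * t) powr (\<alpha> - 1)\<close> cancel the normalising
      \<open>\<beta> powr \<alpha>\<close>.\<close>
    have "\<beta> * \<beta> powr (\<alpha> - 1) = \<beta> powr \<alpha>"
      using \<open>0 < \<beta>\<close> by (simp add: powr_diff)
    then show ?thesis
      using assms True
      by (simp add: gamma_density_def powr_mult exp_minus flip: \<open>\<beta> * _ = _\<close>)
        (simp add: field_simps)
  next
    \<comment> \<open>At t = 0 the indicator is 1, but \<open>0 powr (\<alpha> - 1)\<close> is 0, so
      both sides still vanish.\<close>
    case False
    then show ?thesis
      using assms by (auto simp: gamma_density_def indicator_def zero_less_mult_iff)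
  qed
  have "(\<integral>\<^sup>+ r. ennreal (gamma_density \<alpha> \<beta> r) \<partial>lborel)
      = ennreal \<beta> * (\<integral>\<^sup>+ t. ennreal (gamma_density \<alpha> \<beta> (\<beta> * t)) \<partial>lborel)"
    using assms by (subst nn_integral_real_affine[where c = \<beta> and t = 0]) auto
  also have "\<dots> = (\<integral>\<^sup>+ t. ennreal \<beta> * ennreal (gamma_density \<alpha> \<beta> (\<beta> * t)) \<partial>lborel)"
    by (simp add: nn_integral_cmult)
  also have "\<dots> = (\<integral>\<^sup>+ t. ennreal (inverse (Gamma \<alpha>)) *
      ennreal (indicator {0..} t * t powr (\<alpha> - 1) / exp t) \<partial>lborel)"
    using assms by (simp flip: ennreal_mult' add: scale)
  also have "\<dots> = ennreal (inverse (Gamma \<alpha>)) * ennreal (Gamma \<alpha>)"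
    using assms by (simp add: nn_integral_cmult Gamma_conv_nn_integral_real)
  also have "\<dots> = 1"
    using Gamma_real_pos[OF \<open>0 < \<alpha>\<close>] by (simp flip: ennreal_mult)
  finally show ?thesis .
qed

lemma prob_space_gamma_measure:
  assumes "0 < \<alpha>" "0 < \<beta>"
  shows "prob_space (gamma_measure \<alpha> \<beta>)"
  using nn_integral_gamma_density[OF assms]
  by (intro prob_spaceI) (simp add: gamma_measure_def emeasure_density)

lemma space_gamma_measure [simp]: "space (gamma_measure \<alpha> \<beta>) = UNIV"
  by (simp add: gamma_measure_def)

lemma sets_gamma_measure [measurable_cong, simp]: "sets (gamma_measure \<alpha> \<beta>) = sets borel"
  by (simp add: gamma_measure_def)

lemma AE_gamma_measure_pos: "AE r in gamma_measure \<alpha> \<beta>. 0 < r"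
  unfolding gamma_measure_def
  by (subst AE_density) (auto simp: gamma_density_def intro!: AE_I2)

text \<open>The nonpositive reals are a null set, so the set integrals in the definitions become
  plain expectations.\<close>

lemma set_lebesgue_integral_gamma_measure:
  fixes f :: "real \<Rightarrow> real"
  assumes [measurable]: "f \<in> borel_measurable borel"
  shows "(LINT r:{0<..}|gamma_measure \<alpha> \<beta>. f r) = (LINT r|gamma_measure \<alpha> \<beta>. f r)"
  unfolding set_lebesgue_integral_def
  by (rule integral_cong_AE) (use AE_gamma_measure_pos[of \<alpha> \<beta>] in \<open>auto elim!: eventually_mono\<close>)

text \<open>Multiplying the density by \<open>r powr - p\<close> gives a constant multiple of the
  Gamma density with shape \<alpha> - p > 0, whose integral is finite.\<close>

lemma integrable_powr_gamma_measure:
  assumes "p < \<alpha>" "0 < \<alpha>" "0 < \<beta>"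
  shows "integrable (gamma_measure \<alpha> \<beta>) (\<lambda>r. r powr - p)"
proof -
  have "integrable lborel (gamma_density (\<alpha> - p) \<beta>)"
    using assms nn_integral_gamma_density[of "\<alpha> - p" \<beta>]
    by (intro integrableI_nonneg) (auto simp: gamma_density_nonneg)
  then have int: "integrable lborel
      (\<lambda>r. Gamma (\<alpha> - p) * \<beta> powr (\<alpha> - p) / (Gamma \<alpha> * \<beta> powr \<alpha>) * gamma_density (\<alpha> - p) \<beta> r)"
    by (rule integrable_mult_right)
  have "Gamma (\<alpha> - p) * \<beta> powr (\<alpha> - p) / (Gamma \<alpha> * \<beta> powr \<alpha>) * gamma_density (\<alpha> - p) \<beta> r
      = gamma_density \<alpha> \<beta> r * r powr - p" for r
  proof -
    have "Gamma (\<alpha> - p) > 0" "\<beta> powr (\<alpha> - p) > 0"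
      using assms by auto
    moreover have "r powr (\<alpha> - p - 1) = r powr (\<alpha> - 1) * r powr - p" 
      by (simp flip: powr_add add: algebra_simps)
    ultimately show ?thesis
      by (simp add: gamma_density_def)
  qed
  with int show ?thesis
    using assms unfolding gamma_measure_def
    by (subst integrable_density) (auto simp: gamma_density_nonneg)
qed

lemma integrable_inverse_gamma_measure:
  assumes "1 < \<alpha>" "0 < \<beta>"
  shows "integrable (gamma_measure \<alpha> \<beta>) (\<lambda>r. c / r)"
proof -
  have "integrable (gamma_measure \<alpha> \<beta>) (\<lambda>r. c * r powr - 1)"
    using assms by (intro integrable_mult_right integrable_powr_gamma_measure) auto
  moreover have "AE r in gamma_measure \<alpha> \<beta>. c * r powr - 1 = c / r"
    using AE_gamma_measure_pos by eventually_elim (simp add: powr_minus field_simps)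
  ultimately show ?thesis
    by (intro integrable_cong_AE_imp[where f = "(/) c" and g = "\<lambda>r. c * r powr - 1"]) auto
qed

section \<open>Integrability of the q-exponentials\<close>

lemma integrable_exp_q_upper:
  assumes "1 < \<alpha>" "0 < \<beta>" "0 < q" "q < 1 - 1 / \<alpha>" "0 < l"
  shows "integrable (gamma_measure \<alpha> \<beta>) (\<lambda>r. exp_q q (l / r))"
proof -
  interpret prob_space "gamma_measure \<alpha> \<beta>"
    using assms by (intro prob_space_gamma_measure) auto
  define p where "p = 1 / (1 - q)"
  have "1 / \<alpha> > 0" using assms by simp
  then have q: "q < 1" using assms by linarith
  have p: "0 < p" "p < \<alpha>"
    using assms q by (auto simp: p_def field_simps)
  define c where "c = (1 - q) * l"
  have c: "0 < c" using q assms by (simp add: c_def)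
  \<comment> \<open>With x = c / r this combines 1 + x \<le> 2 max(1, x) with the bound of the p-th
    power of max(1, x) by 1 plus the p-th power of x. Only a constant and the moment of order - p
    remain.\<close>
  have bound: "(1 + c / r) powr p \<le> 2 powr p * (1 + c powr p * r powr - p)" if "0 < r" for r
  proof -
    have "(1 + c / r) powr p \<le> (2 * max 1 (c / r)) powr p"
      using c p that by (intro powr_mono2) auto
    also have "\<dots> = 2 powr p * (max 1 (c / r)) powr p"
      by (simp add: powr_mult)
    also have "(max 1 (c / r)) powr p \<le> 1 + (c / r) powr p"
      by (simp add: max_def)
    also have "(c / r) powr p = c powr p * r powr - p"
      using that c by (simp add: powr_divide powr_minus field_simps)
    finally show ?thesis by simp
  qed
  have "integrable (gamma_measure \<alpha> \<beta>) (\<lambda>r. 2 powr p * (1 + c powr p * r powr - p))"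
    using p assms
    by (intro integrable_mult_right Bochner_Integration.integrable_add integrable_const
        integrable_powr_gamma_measure) auto
  then show ?thesis
  proof (rule Bochner_Integration.integrable_bound)
    show "AE r in gamma_measure \<alpha> \<beta>. norm (exp_q q (l / r))
        \<le> norm (2 powr p * (1 + c powr p * r powr - p))"
      using AE_gamma_measure_pos
    proof eventually_elim
      case (elim r)
      then show ?case
        using bound[of r] q by (simp add: exp_q_def c_def p_def)
    qed
  qed measurable
qed

text \<open>For q \<ge> 1 the q-exponential of a negative number is at most 1, so a constant bound
  suffices on a probability space.\<close>

lemma integrable_exp_q_lower:
  assumes "0 < \<alpha>" "0 < \<beta>" "1 \<le> q" "0 < l"
  shows "integrable (gamma_measure \<alpha> \<beta>) (\<lambda>r. exp_q q (- l / r))"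
proof -
  interpret prob_space "gamma_measure \<alpha> \<beta>"
    using assms by (intro prob_space_gamma_measure) auto
  show ?thesis
  proof (rule integrable_const_bound[where B = 1])
    show "AE r in gamma_measure \<alpha> \<beta>. norm (exp_q q (- l / r)) \<le> 1"
      using AE_gamma_measure_pos
    proof eventually_elim
      case (elim r)
      \<comment> \<open>The base is at least 1 and the exponent is nonpositive. For q = 1 the
        exponent is 1 / 0 = 0 and the inequality is trivial; \<open>exp_q\<close> is then
        \<open>exp\<close>, treated by the final simplification.\<close>
      have "(1 + (1 - q) * (- l / r)) powr (1 / (1 - q)) \<le> 1 powr (1 / (1 - q))"
        using elim assms
        by (intro powr_mono2') (auto simp: mult_nonpos_nonneg divide_nonpos_nonneg)
      then show ?case
        using elim assms by (simp add: exp_q_def)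
    qed
  qed measurable
qed

section \<open>Comparison of the Tsallis values with R\<close>

theorem proposition5:
  fixes \<alpha> \<beta> a b q R :: real and \<pi> :: "real measure"
  assumes "\<alpha> > 1" and "\<beta> > 0"
    and "\<pi> = gamma_measure \<alpha> \<beta>"
    and "R = (LINT r:{0<..}|\<pi>. 1 / r)"
    and "0 < a" and "a \<le> b" and "b \<le> 1"
  shows "(0 < q \<and> q < 1 - 1 / \<alpha> \<longrightarrow>
            upper_TsVaR \<pi> q a \<ge> upper_TsVaR \<pi> q b \<and>
            upper_TsVaR \<pi> q b \<ge> upper_TsVaR \<pi> q 1 \<and>
            upper_TsVaR \<pi> q 1 \<ge> ereal R) \<and>
         (q \<ge> 1 \<longrightarrow>
            lower_TsVaR \<pi> q a \<le> lower_TsVaR \<pi> q b \<and>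
            lower_TsVaR \<pi> q b \<le> lower_TsVaR \<pi> q 1 \<and>
            lower_TsVaR \<pi> q 1 \<le> ereal R)"
proof -
  have "0 < b" and \<alpha>: "0 < \<alpha>"
    using assms by auto
  interpret prob_space \<pi>
    unfolding assms(3) using assms \<alpha> by (intro prob_space_gamma_measure)
  note \<pi> = assms(3)
  have set_int: "(LINT r:{0<..}|\<pi>. f r) = expectation f" if "f \<in> borel_measurable borel"
    for f :: "real \<Rightarrow> real"
    unfolding \<pi> using that by (rule set_lebesgue_integral_gamma_measure)
  \<comment> \<open>The numerator is arbitrary so that c = l serves the upper bound and c = - l the
    lower one.\<close>
  have inv: "integrable \<pi> (\<lambda>r. c / r)" for c
    unfolding \<pi> using assms by (intro integrable_inverse_gamma_measure)
  have mean: "expectation (\<lambda>r. c / r) = c * R" for c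
  proof -
    have "expectation (\<lambda>r. c / r) = expectation (\<lambda>r. c * (1 / r))"
      by simp
    also have "\<dots> = c * expectation (\<lambda>r. 1 / r)"
      by (rule integral_mult_right_zero)
    finally show ?thesis
      by (simp add: assms(4) set_int)
  qed
  have upper: "upper_TsVaR \<pi> q b \<le> upper_TsVaR \<pi> q a" "upper_TsVaR \<pi> q 1 \<le> upper_TsVaR \<pi> q b"
      "ereal R \<le> upper_TsVaR \<pi> q 1" if q: "0 < q" "q < 1 - 1 / \<alpha>"
  proof -
    have "1 / \<alpha> > 0" using \<alpha> by simp
    then have "q < 1" using q by linarith
    have int: "integrable \<pi> (\<lambda>r. exp_q q (l / r))" if "0 < l" for l
      unfolding \<pi> using assms q that by (intro integrable_exp_q_upper)
    have sgn: "AE r in \<pi>. 0 \<le> (1 - q) * (l / r)" if "0 < l" for l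
      unfolding \<pi> using AE_gamma_measure_pos
      by eventually_elim (use \<open>q < 1\<close> that in simp)
    have pos: "0 < (LINT r:{0<..}|\<pi>. exp_q q (l / r))" if "0 < l" for l
      using expectation_exp_q_pos[OF q(1) inv int[OF that] sgn[OF that]] by (simp add: set_int)
    show "upper_TsVaR \<pi> q b \<le> upper_TsVaR \<pi> q a"
      using \<open>0 < a\<close> \<open>a \<le> b\<close> pos by (rule upper_TsVaR_antimono)
    show "upper_TsVaR \<pi> q 1 \<le> upper_TsVaR \<pi> q b"
      using \<open>0 < b\<close> \<open>b \<le> 1\<close> pos by (rule upper_TsVaR_antimono)
    show "ereal R \<le> upper_TsVaR \<pi> q 1"
      unfolding upper_TsVaR_def
    proof (rule INF_greatest)
      fix l :: real assume "l \<in> {0<..}"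
      then have l: "0 < l" by simp
      \<comment> \<open>Jensen for X = l / r, whose mean is l R; division by l > 0 gives the bound
        for every term of the infimum.\<close>
      have "l * R \<le> ln_q q (expectation (\<lambda>r. exp_q q (l / r)))"
        using expectation_le_ln_q[OF q(1) inv int[OF l] sgn[OF l]] by (simp add: mean)
      then show "ereal R \<le> ereal (1 / l * ln_q q (1 / 1 * (LINT r:{0<..}|\<pi>. exp_q q (l / r))))"
        using l by (simp add: set_int field_simps)
    qed
  qed
  have lower: "lower_TsVaR \<pi> q a \<le> lower_TsVaR \<pi> q b" "lower_TsVaR \<pi> q b \<le> lower_TsVaR \<pi> q 1"
      "lower_TsVaR \<pi> q 1 \<le> ereal R" if q: "1 \<le> q"
  proof -
    have "0 < q" using q by simp
    have int: "integrable \<pi> (\<lambda>r. exp_q q (- l / r))" if "0 < l" for l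
      unfolding \<pi> using assms \<alpha> q that by (intro integrable_exp_q_lower)
    have sgn: "AE r in \<pi>. 0 \<le> (1 - q) * (- l / r)" if "0 < l" for l
      unfolding \<pi> using AE_gamma_measure_pos
    proof eventually_elim
      case (elim r)
      then show ?case
        using q that by (intro mult_nonpos_nonpos) auto
    qed
    have pos: "0 < (LINT r:{0<..}|\<pi>. exp_q q (- l / r))" if "0 < l" for l
      using expectation_exp_q_pos[OF \<open>0 < q\<close> inv int[OF that] sgn[OF that]]
      by (subst set_int) auto
    show "lower_TsVaR \<pi> q a \<le> lower_TsVaR \<pi> q b"
      using \<open>0 < a\<close> \<open>a \<le> b\<close> pos by (rule lower_TsVaR_mono)
    show "lower_TsVaR \<pi> q b \<le> lower_TsVaR \<pi> q 1"
      using \<open>0 < b\<close> \<open>b \<le> 1\<close> pos by (rule lower_TsVaR_mono)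
    show "lower_TsVaR \<pi> q 1 \<le> ereal R"
      unfolding lower_TsVaR_def
    proof (rule SUP_least)
      fix l :: real assume "l \<in> {0<..}"
      then have l: "0 < l" by simp
      \<comment> \<open>Jensen for X = - l / r; division by - l reverses the inequality, so every
        term of the supremum is at most R.\<close>
      have "- l * R \<le> ln_q q (expectation (\<lambda>r. exp_q q (- l / r)))"
        using expectation_le_ln_q[OF \<open>0 < q\<close> inv int[OF l] sgn[OF l]] unfolding mean .
      then have "- l * R \<le> ln_q q (LINT r:{0<..}|\<pi>. exp_q q (- l / r))"
        by (subst set_int) auto
      then show "ereal (- (1 / l) * ln_q q (1 / 1 * (LINT r:{0<..}|\<pi>. exp_q q (- l / r)))) \<le> ereal R"
        using l by (simp add: field_simps)
    qed
  qed
  show ?thesis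
    using upper lower by blast
qed

end
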